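(* Let $S$ be a strict complete stable marriage instance of size $n$, let $S_m$ be a set of men and $S_w$ a set of women, $a=|S_m|$, $b=|S_w|$, let $T_w$ be the set of women not in $S_w$ and $T_m$ the set of men not in $S_m$. There is a complete matching $\mu$ such that every pair in $S_m\times S_w$ is a blocking pair of $\mu$ if and only if both of the following hold: (H1) the bipartite graph on $(S_m,T_w)$ with $i\sim w$ iff $r_M(i,w)>\max_{j\in S_w}r_M(i,j)$ has a matching saturating $S_m$; (H2) the bipartite graph on $(S_w,T_m)$ with $j\sim i'$ iff $r_W(j,i')>\max_{i\in S_m}r_W(j,i)$ has a matching saturating $S_w$. Moreover, when these equivalent conditions hold, $a+b\le n$ and $\beta(S)\ge ab$.
   Context: An instance $S$ of size $n$ consists of $n$ men and $n$ women, each with a strict complete preference order on the other side. $r_M(i,j)\in\{1,\dots,n\}$ is the rank of woman $j$ in man $i$'s list and $r_W(j,i)\in\{1,\dots,n\}$ the rank of man $i$ in woman $j$'s list (1 is best). A complete matching is a bijection $\mu$ from men to women. $(i,j)$ blocks $\mu$ if man $i$ strictly prefers woman $j$ to his partner under $\mu$ and woman $j$ strictly prefers man $i$ to her partner under $\mu$; $B_S(\mu)$ is the number of blocking pairs and $\beta(S)=\max_\mu B_S(\mu)$. The maximum over an empty set of ranks is read as $0$. *)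

theory Defs
  imports Main
begin

(* (x, y) \<in> prefM S i reads "man i strictly prefers woman x to woman y"; likewise for prefW. *)
record ('m, 'w) instance_sm =
  men :: "'m set"
  women :: "'w set"
  prefM :: "'m \<Rightarrow> ('w \<times> 'w) set"
  prefW :: "'w \<Rightarrow> ('m \<times> 'm) set"

definition sm_instance :: "('m, 'w) instance_sm \<Rightarrow> nat \<Rightarrow> bool" where
  "sm_instance S n \<longleftrightarrow>
     finite (men S) \<and> card (men S) = n \<and> finite (women S) \<and> card (women S) = n \<and>
     (\<forall>i\<in>men S. prefM S i \<subseteq> women S \<times> women S \<and> strict_linear_order_on (women S) (prefM S i)) \<and>
     (\<forall>j\<in>women S. prefW S j \<subseteq> men S \<times> men S \<and> strict_linear_order_on (men S) (prefW S j))"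

(* Position in the preference list, counted from 1 (best). *)
definition rank_in :: "'a set \<Rightarrow> ('a \<times> 'a) set \<Rightarrow> 'a \<Rightarrow> nat" where
  "rank_in A r x = card {y \<in> A. (y, x) \<in> r} + 1"

definition rM :: "('m, 'w) instance_sm \<Rightarrow> 'm \<Rightarrow> 'w \<Rightarrow> nat" where
  "rM S i j = rank_in (women S) (prefM S i) j"

definition rW :: "('m, 'w) instance_sm \<Rightarrow> 'w \<Rightarrow> 'm \<Rightarrow> nat" where
  "rW S j i = rank_in (men S) (prefW S j) i"

definition complete_matching :: "('m, 'w) instance_sm \<Rightarrow> ('m \<Rightarrow> 'w) \<Rightarrow> bool" where
  "complete_matching S \<mu> \<longleftrightarrow> bij_betw \<mu> (men S) (women S)"

definition blocks :: "('m, 'w) instance_sm \<Rightarrow> ('m \<Rightarrow> 'w) \<Rightarrow> 'm \<Rightarrow> 'w \<Rightarrow> bool" where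
  "blocks S \<mu> i j \<longleftrightarrow> i \<in> men S \<and> j \<in> women S \<and>
     (j, \<mu> i) \<in> prefM S i \<and> (i, inv_into (men S) \<mu> j) \<in> prefW S j"

definition num_blocking :: "('m, 'w) instance_sm \<Rightarrow> ('m \<Rightarrow> 'w) \<Rightarrow> nat" where
  "num_blocking S \<mu> = card {(i, j). blocks S \<mu> i j}"

(* Matchings are unconstrained outside men S, so there may be infinitely many functions \<mu>;
   the set of values is nevertheless finite and nonempty for every instance. *)
definition beta :: "('m, 'w) instance_sm \<Rightarrow> nat" where
  "beta S = Max {num_blocking S \<mu> | \<mu>. complete_matching S \<mu>}"

definition max_rank :: "nat set \<Rightarrow> nat" where
  "max_rank R = (if R = {} then 0 else Max R)"

(* A bipartite graph is given by its edges, oriented from the left to the right side. *)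
definition bip_matching :: "('a \<times> 'b) set \<Rightarrow> ('a \<times> 'b) set \<Rightarrow> bool" where
  "bip_matching E M \<longleftrightarrow> M \<subseteq> E \<and>
     (\<forall>e\<in>M. \<forall>f\<in>M. e \<noteq> f \<longrightarrow> fst e \<noteq> fst f \<and> snd e \<noteq> snd f)"

definition has_matching_saturating :: "('a \<times> 'b) set \<Rightarrow> 'a set \<Rightarrow> bool" where
  "has_matching_saturating E X \<longleftrightarrow> (\<exists>M. bip_matching E M \<and> (\<forall>x\<in>X. \<exists>y. (x, y) \<in> M))"

definition graph_M :: "('m, 'w) instance_sm \<Rightarrow> 'm set \<Rightarrow> 'w set \<Rightarrow> ('m \<times> 'w) set" where
  "graph_M S Sm Sw = {(i, w). i \<in> Sm \<and> w \<in> women S - Sw \<and> rM S i w > max_rank (rM S i ` Sw)}"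

definition graph_W :: "('m, 'w) instance_sm \<Rightarrow> 'm set \<Rightarrow> 'w set \<Rightarrow> ('w \<times> 'm) set" where
  "graph_W S Sm Sw = {(j, i). j \<in> Sw \<and> i \<in> men S - Sm \<and> rW S j i > max_rank (rW S j ` Sm)}"

end

theory Submission
  imports Defs
begin

text \<open>
  If all pairs of \<open>Sm \<times> Sw\<close> block \<open>\<mu>\<close>, then no man of \<open>Sm\<close> is married into \<open>Sw\<close>, since a
  couple never blocks; hence \<open>\<mu>\<close> and its inverse restrict to the two saturating matchings.
  Conversely, the two matchings cover disjoint sets of men and disjoint sets of women,
  so they glue to a partial matching, and any completion of it is blocked by \<open>Sm \<times> Sw\<close>.
\<close>

text \<open>If \<open>u\<close> precedes \<open>v\<close>, transitivity puts everything above
  \<open>u\<close> also above \<open>v\<close>, and \<open>u\<close> itself lies above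
  \<open>v\<close> but not above \<open>u\<close>, so the rank grows strictly. Totality yields the
  converse.\<close>

lemma rank_in_less_iff:
  assumes "finite A" "r \<subseteq> A \<times> A" "strict_linear_order_on A r" "x \<in> A" "y \<in> A"
  shows "rank_in A r x < rank_in A r y \<longleftrightarrow> (x, y) \<in> r"
proof -
  have tr: "trans r" and irr: "irrefl r" and tot: "total_on A r"
    using assms(3) by (auto simp: strict_linear_order_on_def)
  have mono: "rank_in A r u < rank_in A r v" if "(u, v) \<in> r" for u v
  proof -
    have "u \<in> A" using that assms(2) by blast
    then have "{z \<in> A. (z, u) \<in> r} \<subset> {z \<in> A. (z, v) \<in> r}"
      using that tr irr by (auto simp: irrefl_def dest: transD)
    then show ?thesis
      unfolding rank_in_def using assms(1) by (simp add: psubset_card_mono)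
  qed
  show ?thesis
    using mono tot assms(4,5) unfolding total_on_def by (metis less_asym less_irrefl)
qed

lemma max_rank_less_iff:
  assumes "finite A" "r \<subseteq> A \<times> A" "strict_linear_order_on A r" "B \<subseteq> A" "w \<in> A"
  shows "max_rank (rank_in A r ` B) < rank_in A r w \<longleftrightarrow> (\<forall>x\<in>B. (x, w) \<in> r)"
proof (cases "B = {}")
  case True
  \<comment> \<open>Ranks start at 1, so they always exceed the default value 0; the right-hand side
    is vacuously true.\<close>
  then show ?thesis by (simp add: max_rank_def rank_in_def)
next
  case False
  moreover have "finite B" using assms(1,4) by (rule rev_finite_subset)
  ultimately have "max_rank (rank_in A r ` B) < rank_in A r w \<longleftrightarrow>
      (\<forall>x\<in>B. rank_in A r x < rank_in A r w)"
    by (simp add: max_rank_def)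
  also have "\<dots> \<longleftrightarrow> (\<forall>x\<in>B. (x, w) \<in> r)"
    using rank_in_less_iff[OF assms(1-3) _ assms(5)] assms(4) by blast
  finally show ?thesis .
qed

text \<open>Trades edge sets for injective choice functions, which can be glued into bijections.
  Choosing an edge of \<open>M\<close> at each vertex of \<open>X\<close> is injective because
  distinct edges of \<open>M\<close> have distinct right ends.\<close>

lemma has_matching_saturating_iff:
  "has_matching_saturating E X \<longleftrightarrow> (\<exists>f. inj_on f X \<and> (\<forall>x\<in>X. (x, f x) \<in> E))"
proof
  assume "has_matching_saturating E X"
  then obtain M where M: "M \<subseteq> E"
      "\<And>e f. e \<in> M \<Longrightarrow> f \<in> M \<Longrightarrow> e \<noteq> f \<Longrightarrow> snd e \<noteq> snd f"
      "\<forall>x\<in>X. \<exists>y. (x, y) \<in> M"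
    unfolding has_matching_saturating_def bip_matching_def by blast
  obtain f where f: "\<forall>x\<in>X. (x, f x) \<in> M" using M(3) by metis
  have "inj_on f X" using f M(2) by (metis fst_conv inj_onI snd_conv)
  then show "\<exists>f. inj_on f X \<and> (\<forall>x\<in>X. (x, f x) \<in> E)" using f M(1) by blast
next
  assume "\<exists>f. inj_on f X \<and> (\<forall>x\<in>X. (x, f x) \<in> E)"
  then obtain f where "inj_on f X" "\<forall>x\<in>X. (x, f x) \<in> E" by blast
  then have "bip_matching E ((\<lambda>x. (x, f x)) ` X)"
    unfolding bip_matching_def by (auto dest: inj_onD)
  then show "has_matching_saturating E X"
    unfolding has_matching_saturating_def by blast
qed

text \<open>The gluing step. Since \<open>g\<close> Y\<open>avoids\<close>X\<open>and\<close>f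
  \<open>X\<close> avoids \<open>Y\<close>, the map \<open>f\<close> and the inverse of
  \<open>g\<close> have disjoint domains and disjoint ranges, so together they form a partial
  bijection. The leftover parts of \<open>A\<close> and \<open>B\<close> have equal size and can be
  paired arbitrarily.\<close>

lemma bij_betw_extending:
  assumes "finite A" "finite B" "card A = card B"
    and X: "X \<subseteq> A" and Y: "Y \<subseteq> B"
    and f: "inj_on f X" "f ` X \<subseteq> B - Y" and g: "inj_on g Y" "g ` Y \<subseteq> A - X"
  obtains \<mu> where "bij_betw \<mu> A B" "\<forall>x\<in>X. \<mu> x = f x" "\<forall>y\<in>Y. \<mu> (g y) = y"
proof -
  define k where "k x = (if x \<in> X then f x else inv_into Y g x)" for x
  have k: "bij_betw k (X \<union> g ` Y) (f ` X \<union> Y)"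
    unfolding k_def using f g
    by (intro bij_betw_disjoint_Un bij_betw_inv_into) (auto simp: bij_betw_def)
  have sub: "X \<union> g ` Y \<subseteq> A" "f ` X \<union> Y \<subseteq> B" using X Y f g by auto
  have "card (A - (X \<union> g ` Y)) = card (B - (f ` X \<union> Y))"
    using sub assms(1-3) bij_betw_same_card[OF k] card_Diff_subset finite_subset by metis
  then obtain h where h: "bij_betw h (A - (X \<union> g ` Y)) (B - (f ` X \<union> Y))"
    using assms(1,2) finite_same_card_bij by blast
  define \<mu> where "\<mu> x = (if x \<in> X \<union> g ` Y then k x else h x)" for x
  have "bij_betw \<mu> ((X \<union> g ` Y) \<union> (A - (X \<union> g ` Y))) ((f ` X \<union> Y) \<union> (B - (f ` X \<union> Y)))"
    unfolding \<mu>_def using k h by (intro bij_betw_disjoint_Un) auto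
  then have "bij_betw \<mu> A B" using sub by (simp add: Un_absorb1)
  moreover have "\<forall>x\<in>X. \<mu> x = f x" by (simp add: \<mu>_def k_def)
  moreover have "\<forall>y\<in>Y. \<mu> (g y) = y"
    using g by (auto simp: \<mu>_def k_def)
  ultimately show ?thesis using that by blast
qed

text \<open>Together with its mirror image for women, this lets the blocking arguments compare
  preferences directly, as \<open>blocks\<close> does, without ranks.\<close>

lemma graph_M_iff:
  assumes "sm_instance S n" "Sm \<subseteq> men S" "Sw \<subseteq> women S" "i \<in> Sm"
  shows "(i, w) \<in> graph_M S Sm Sw \<longleftrightarrow>
    w \<in> women S - Sw \<and> (\<forall>j\<in>Sw. (j, w) \<in> prefM S i)"
  using assms max_rank_less_iff[of "women S" "prefM S i" Sw w]
  unfolding graph_M_def sm_instance_def rM_def[abs_def] by auto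

lemma graph_W_iff:
  assumes "sm_instance S n" "Sm \<subseteq> men S" "Sw \<subseteq> women S" "j \<in> Sw"
  shows "(j, i) \<in> graph_W S Sm Sw \<longleftrightarrow>
    i \<in> men S - Sm \<and> (\<forall>i'\<in>Sm. (i', i) \<in> prefW S j)"
  using assms max_rank_less_iff[of "men S" "prefW S j" Sm i]
  unfolding graph_W_def sm_instance_def rW_def[abs_def] by auto

text \<open>Otherwise \<open>j\<close> would be strictly preferred to itself, against
  irreflexivity.\<close>

lemma blocks_not_partner:
  assumes "sm_instance S n" "blocks S \<mu> i j"
  shows "\<mu> i \<noteq> j"
  using assms unfolding sm_instance_def blocks_def strict_linear_order_on_def irrefl_def
  by blast

lemma num_blocking_le_beta:
  assumes "sm_instance S n" "complete_matching S \<mu>"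
  shows "num_blocking S \<mu> \<le> beta S"
proof -
  have fin: "finite (men S \<times> women S)"
    using assms(1) by (simp add: sm_instance_def)
  \<comment> \<open>A bound uniform in \<open>\<nu>\<close> makes the set of values finite, so that
    \<open>Max\<close> is an upper bound for it.\<close>
  have "num_blocking S \<nu> \<le> card (men S \<times> women S)" for \<nu>
    unfolding num_blocking_def by (rule card_mono[OF fin]) (auto simp: blocks_def)
  then have "{num_blocking S \<nu> | \<nu>. complete_matching S \<nu>} \<subseteq> {..card (men S \<times> women S)}"
    by auto
  then have "finite {num_blocking S \<nu> | \<nu>. complete_matching S \<nu>}"
    by (rule finite_subset) simp
  then show ?thesis unfolding beta_def using assms(2) by (intro Max_ge) auto
qed

lemma all_blocking_imp_saturating:
  assumes inst: "sm_instance S n" and Sm: "Sm \<subseteq> men S" and Sw: "Sw \<subseteq> women S"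
    and cm: "complete_matching S \<mu>" and bl: "\<forall>i\<in>Sm. \<forall>j\<in>Sw. blocks S \<mu> i j"
  shows "has_matching_saturating (graph_M S Sm Sw) Sm"
    and "has_matching_saturating (graph_W S Sm Sw) Sw"
proof -
  let ?\<nu> = "inv_into (men S) \<mu>"
  have bij: "bij_betw \<mu> (men S) (women S)" using cm by (simp add: complete_matching_def)
  have bij': "bij_betw ?\<nu> (women S) (men S)" by (rule bij_betw_inv_into[OF bij])
  \<comment> \<open>If \<open>\<mu> i\<close> were in \<open>Sw\<close>, the couple
    \<open>(i, \<mu> i)\<close> would have to block.\<close>
  have "\<mu> i \<in> women S - Sw" if "i \<in> Sm" for i
    using that Sm bl blocks_not_partner[OF inst] bij_betwE[OF bij] by blast
  moreover have "inj_on \<mu> Sm" using bij Sm by (meson bij_betw_def inj_on_subset)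
  ultimately show "has_matching_saturating (graph_M S Sm Sw) Sm"
    unfolding has_matching_saturating_iff using bl
    by (intro exI[of _ \<mu>]) (auto simp: graph_M_iff[OF inst Sm Sw] blocks_def)
  have "?\<nu> j \<in> men S - Sm" if "j \<in> Sw" for j
  proof -
    \<comment> \<open>This identifies \<open>(?\<nu> j, j)\<close> as a couple of
      \<open>\<mu>\<close>; were \<open>?\<nu> j\<close> in \<open>Sm\<close>, it would
      block.\<close>
    have "\<mu> (?\<nu> j) = j" using that Sw bij by (auto simp: bij_betw_inv_into_right)
    then show ?thesis
      using that Sw bl blocks_not_partner[OF inst] bij_betwE[OF bij'] by blast
  qed
  moreover have "inj_on ?\<nu> Sw" using bij' Sw by (meson bij_betw_def inj_on_subset)
  ultimately show "has_matching_saturating (graph_W S Sm Sw) Sw"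
    unfolding has_matching_saturating_iff using bl
    by (intro exI[of _ ?\<nu>]) (auto simp: graph_W_iff[OF inst Sm Sw] blocks_def)
qed

lemma saturating_imp_all_blocking:
  assumes inst: "sm_instance S n" and Sm: "Sm \<subseteq> men S" and Sw: "Sw \<subseteq> women S"
    and H1: "has_matching_saturating (graph_M S Sm Sw) Sm"
    and H2: "has_matching_saturating (graph_W S Sm Sw) Sw"
  obtains \<mu> where "complete_matching S \<mu>" "\<forall>i\<in>Sm. \<forall>j\<in>Sw. blocks S \<mu> i j"
proof -
  obtain f where f: "inj_on f Sm" "\<forall>i\<in>Sm. (i, f i) \<in> graph_M S Sm Sw"
    using H1 unfolding has_matching_saturating_iff by blast
  obtain g where g: "inj_on g Sw" "\<forall>j\<in>Sw. (j, g j) \<in> graph_W S Sm Sw"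
    using H2 unfolding has_matching_saturating_iff by blast
  have f': "f ` Sm \<subseteq> women S - Sw" "\<And>i j. i \<in> Sm \<Longrightarrow> j \<in> Sw \<Longrightarrow> (j, f i) \<in> prefM S i"
    using f(2) by (auto simp: graph_M_iff[OF inst Sm Sw])
  have g': "g ` Sw \<subseteq> men S - Sm" "\<And>i j. i \<in> Sm \<Longrightarrow> j \<in> Sw \<Longrightarrow> (i, g j) \<in> prefW S j"
    using g(2) by (auto simp: graph_W_iff[OF inst Sm Sw])
  have "finite (men S)" "finite (women S)" "card (men S) = card (women S)"
    using inst by (auto simp: sm_instance_def)
  from bij_betw_extending[OF this Sm Sw f(1) f'(1) g(1) g'(1)]
  obtain \<mu> where \<mu>: "bij_betw \<mu> (men S) (women S)" "\<forall>i\<in>Sm. \<mu> i = f i" "\<forall>j\<in>Sw. \<mu> (g j) = j"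
    by blast
  \<comment> \<open>Blocking refers to the husband of \<open>j\<close> through the inverse of
    \<open>\<mu>\<close>. As \<open>g j\<close> is a man sent to \<open>j\<close>, injectivity
    identifies him. The edges of \<open>f\<close> then supply the men's half of blocking, those of
    \<open>g\<close> the women's half.\<close>
  have "inv_into (men S) \<mu> j = g j" if "j \<in> Sw" for j
    using that \<mu>(1,3) g'(1) by (intro inv_into_f_eq) (auto simp: bij_betw_def)
  then have "\<forall>i\<in>Sm. \<forall>j\<in>Sw. blocks S \<mu> i j"
    using \<mu>(2) f'(2) g'(2) Sm Sw by (auto simp: blocks_def)
  then show ?thesis using that \<mu>(1) by (simp add: complete_matching_def)
qed

lemma saturating_imp_card_le:
  assumes inst: "sm_instance S n" and Sm: "Sm \<subseteq> men S" and Sw: "Sw \<subseteq> women S"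
    and H1: "has_matching_saturating (graph_M S Sm Sw) Sm"
  shows "card Sm + card Sw \<le> n"
proof -
  obtain f where f: "inj_on f Sm" "\<forall>i\<in>Sm. (i, f i) \<in> graph_M S Sm Sw"
    using H1 unfolding has_matching_saturating_iff by blast
  have fin: "finite (women S)" "card (women S) = n" using inst by (auto simp: sm_instance_def)
  have "f ` Sm \<subseteq> women S - Sw" using f(2) by (auto simp: graph_M_def)
  then have "card Sm \<le> card (women S - Sw)"
    using f(1) fin by (metis card_inj_on_le finite_Diff)
  also have "\<dots> = n - card Sw" using fin Sw by (simp add: card_Diff_subset finite_subset)
  \<comment> \<open>The subtraction is truncated, so \<open>card Sw \<le> n\<close> is needed to
    move it across.\<close>
  finally show ?thesis using card_mono[OF fin(1) Sw] fin(2) by linarith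
qed

text \<open>The product \<open>Sm \<times> Sw\<close> is contained in the finite set of blocking
  pairs of \<open>\<mu>\<close>, whose size is at most the maximum.\<close>

lemma all_blocking_imp_beta_ge:
  assumes inst: "sm_instance S n"
    and cm: "complete_matching S \<mu>" and bl: "\<forall>i\<in>Sm. \<forall>j\<in>Sw. blocks S \<mu> i j"
  shows "card Sm * card Sw \<le> beta S"
proof -
  have "{(i, j). blocks S \<mu> i j} \<subseteq> men S \<times> women S" by (auto simp: blocks_def)
  then have "finite {(i, j). blocks S \<mu> i j}"
    using inst by (auto simp: sm_instance_def elim: finite_subset)
  then have "card (Sm \<times> Sw) \<le> num_blocking S \<mu>"
    unfolding num_blocking_def using bl by (intro card_mono) auto
  then show ?thesis using num_blocking_le_beta[OF inst cm] by (simp add: card_cartesian_product)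
qed

theorem lemma6p1:
  fixes S :: "('m, 'w) instance_sm" and n a b :: nat and Sm :: "'m set" and Sw :: "'w set"
  assumes "sm_instance S n"
    and "Sm \<subseteq> men S" and "Sw \<subseteq> women S"
    and "a = card Sm" and "b = card Sw"
  shows "((\<exists>\<mu>. complete_matching S \<mu> \<and> (\<forall>i\<in>Sm. \<forall>j\<in>Sw. blocks S \<mu> i j)) \<longleftrightarrow>
          has_matching_saturating (graph_M S Sm Sw) Sm \<and>
          has_matching_saturating (graph_W S Sm Sw) Sw) \<and>
         (has_matching_saturating (graph_M S Sm Sw) Sm \<and>
          has_matching_saturating (graph_W S Sm Sw) Sw \<longrightarrow>
          a + b \<le> n \<and> beta S \<ge> a * b)"
proof -
  have eqv: "(\<exists>\<mu>. complete_matching S \<mu> \<and> (\<forall>i\<in>Sm. \<forall>j\<in>Sw. blocks S \<mu> i j)) \<longleftrightarrow>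
      has_matching_saturating (graph_M S Sm Sw) Sm \<and> has_matching_saturating (graph_W S Sm Sw) Sw"
    using all_blocking_imp_saturating[OF assms(1-3)] saturating_imp_all_blocking[OF assms(1-3)]
    by metis
  \<comment> \<open>The bound on \<open>beta S\<close> needs an actual matching; the equivalence
    provides one from the two saturation conditions.\<close>
  then show ?thesis
    using saturating_imp_card_le[OF assms(1-3)] all_blocking_imp_beta_ge[OF assms(1)] assms(4,5)
    by blast
qed

end
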